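(* Let $k \geq 0$ be an integer, and let $G$ be a simple graph with $m$ edges and no isolated vertices, where $$m \geq \max\{7k+31,\ k^2+8(k+1)\}.$$ If $q(G) \geq q(S^+_{m,k+1})$, then $G$ contains a $4$-cycle $C_4$ or a star $K_{1,m-k}$ as a subgraph, unless $G \cong S^+_{m,k+1}$.
   Context: For a simple graph $G$, $Q(G)=D(G)+A(G)$ is the signless Laplacian matrix, where $D(G)$ is the diagonal matrix of vertex degrees and $A(G)$ is the adjacency matrix; $q(G)$ denotes the largest eigenvalue of $Q(G)$ (the signless Laplacian spectral radius). $K_{1,t}$ is the star with $t$ edges. $S^+_{m,k+1}$ denotes the graph with $m$ edges obtained from the star $K_{1,m-k-1}$ by adding $k+1$ pairwise independent (vertex-disjoint) edges, each joining two leaves of the star. *)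

theory Defs
  imports
    "Graph_Theory.Graph_Theory"
    "Jordan_Normal_Form.Spectral_Radius"
begin

text \<open>
  A finite simple graph is a \<^locale>\<open>pair_graph\<close>: a finite, loop-free, symmetric digraph without
  parallel arcs. An undirected edge is represented by two opposite arcs, so the degree of a vertex
  is its out-degree, and the edges are the unordered pairs of ends of arcs.
\<close>

definition edge_count :: "'a pair_pre_digraph \<Rightarrow> nat" where
  "edge_count G = card ((\<lambda>(u, v). {u, v}) ` parcs G)"

abbreviation vdegree :: "'a pair_pre_digraph \<Rightarrow> 'a \<Rightarrow> nat" where
  "vdegree G v \<equiv> out_degree (with_proj G) v"

definition adjacency_matrix :: "'a pair_pre_digraph \<Rightarrow> 'a list \<Rightarrow> real mat" where
  "adjacency_matrix G vs = mat (length vs) (length vs)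
     (\<lambda>(i, j). if (vs ! i, vs ! j) \<in> parcs G then 1 else 0)"

definition degree_matrix :: "'a pair_pre_digraph \<Rightarrow> 'a list \<Rightarrow> real mat" where
  "degree_matrix G vs = mat (length vs) (length vs)
     (\<lambda>(i, j). if i = j then real (vdegree G (vs ! i)) else 0)"

definition signless_laplacian :: "'a pair_pre_digraph \<Rightarrow> 'a list \<Rightarrow> real mat" where
  "signless_laplacian G vs = degree_matrix G vs + adjacency_matrix G vs"

text \<open>
  Rows and columns are indexed by an enumeration of the vertices; by
  \<open>signless_laplacian_spectrum_enum_indep\<close> below its choice does not affect the spectrum.
\<close>

definition vertex_enum :: "'a pair_pre_digraph \<Rightarrow> 'a list" where
  "vertex_enum G = (SOME vs. distinct vs \<and> set vs = pverts G)"

text \<open>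
  The signless Laplacian is real symmetric, so its real spectrum is nonempty as soon as there is
  a vertex. For the null graph the value below is unspecified.
\<close>

definition q_index :: "'a pair_pre_digraph \<Rightarrow> real" where
  "q_index G = Max (spectrum (signless_laplacian G (vertex_enum G)))"

definition cycle_graph :: "nat \<Rightarrow> nat pair_pre_digraph" where
  "cycle_graph n = \<lparr> pverts = {..<n},
     parcs = {(i, j). i < n \<and> j < n \<and> (j = (i + 1) mod n \<or> i = (j + 1) mod n)} \<rparr>"

text \<open>
  \<open>star_plus m s\<close> is the graph $S^+_{m,s}$ with \<open>m\<close> edges: centre \<open>0\<close>, leaves
  \<open>1, ..., m - s\<close>, and the \<open>s\<close> additional independent edges between the leaves
  \<open>2 * i - 1\<close> and \<open>2 * i\<close>. It is meaningful only if there are enough leaves, i.e. \<open>3 * s \<le> m\<close>.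
\<close>

definition star_plus :: "nat \<Rightarrow> nat \<Rightarrow> nat pair_pre_digraph" where
  "star_plus m s = \<lparr> pverts = {0..m - s},
     parcs = (\<Union>i\<in>{1..m - s}. {(0, i), (i, 0)})
           \<union> (\<Union>i\<in>{1..s}. {(2 * i - 1, 2 * i), (2 * i, 2 * i - 1)}) \<rparr>"

definition contains_cycle_graph :: "nat \<Rightarrow> 'a pair_pre_digraph \<Rightarrow> bool" where
  "contains_cycle_graph n G \<longleftrightarrow>
     (\<exists>H. subgraph H (with_proj G) \<and> digraph_iso (with_proj (cycle_graph n)) H)"

definition contains_star :: "nat \<Rightarrow> 'a pair_pre_digraph \<Rightarrow> bool" where
  "contains_star t G \<longleftrightarrow>
     (\<exists>H. subgraph H (with_proj G) \<and> complete_bipartite_digraph 1 t H)"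


lemma signless_laplacian_nth:
  assumes "i < length vs" "j < length vs"
  shows "signless_laplacian G vs $$ (i, j) =
    (if i = j then real (vdegree G (vs ! i)) else 0) +
    (if (vs ! i, vs ! j) \<in> parcs G then 1 else 0)"
  using assms by (simp add: signless_laplacian_def degree_matrix_def adjacency_matrix_def)

lemma eigenvalue_signless_laplacian_iff:
  assumes "distinct vs"
  shows "eigenvalue (signless_laplacian G vs) x \<longleftrightarrow>
    (\<exists>f :: 'a \<Rightarrow> real. (\<exists>v\<in>set vs. f v \<noteq> 0) \<and>
      (\<forall>v\<in>set vs. real (vdegree G v) * f v + (\<Sum>w\<in>set vs. if (v, w) \<in> parcs G then f w else 0)
        = x * f v))" (is "?L \<longleftrightarrow> ?R")
proof -
  let ?n = "length vs" and ?Q = "signless_laplacian G vs"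
  have dims: "dim_row ?Q = ?n" "dim_col ?Q = ?n"
    by (simp_all add: signless_laplacian_def adjacency_matrix_def)
  have row: "(?Q *\<^sub>v u) $ i = real (vdegree G (vs ! i)) * u $ i
      + (\<Sum>w\<in>set vs. if (vs ! i, w) \<in> parcs G then f w else 0)"
    if u: "u \<in> carrier_vec ?n" and i: "i < ?n" and f: "\<And>j. j < ?n \<Longrightarrow> u $ j = f (vs ! j)"
    for u i f
  proof -
    have "(?Q *\<^sub>v u) $ i = (\<Sum>j<?n. ?Q $$ (i, j) * u $ j)"
      using u i dims by (simp add: scalar_prod_def atLeast0LessThan)
    also have "\<dots> = (\<Sum>j<?n. (if i = j then real (vdegree G (vs ! i)) * u $ j else 0)
        + (if (vs ! i, vs ! j) \<in> parcs G then f (vs ! j) else 0))"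
      using i f by (intro sum.cong) (auto simp: signless_laplacian_nth algebra_simps)
    also have "\<dots> = real (vdegree G (vs ! i)) * u $ i
        + (\<Sum>j<?n. if (vs ! i, vs ! j) \<in> parcs G then f (vs ! j) else 0)"
      using i by (simp add: sum.distrib)
    also have "(\<Sum>j<?n. if (vs ! i, vs ! j) \<in> parcs G then f (vs ! j) else 0)
        = (\<Sum>w\<in>set vs. if (vs ! i, w) \<in> parcs G then f w else 0)"
      by (rule sum.reindex_bij_betw[OF bij_betw_nth[OF assms refl refl]])
    finally show ?thesis .
  qed
  show ?thesis
  proof
    assume ?L
    then obtain u where u: "u \<in> carrier_vec ?n" "u \<noteq> 0\<^sub>v ?n" "?Q *\<^sub>v u = x \<cdot>\<^sub>v u"
      by (auto simp: eigenvalue_def eigenvector_def dims)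
    define f where "f v = u $ (the_inv_into {..<?n} ((!) vs) v)" for v
    have inj: "inj_on ((!) vs) {..<?n}"
      using assms by (simp add: inj_on_nth)
    have f: "u $ j = f (vs ! j)" if "j < ?n" for j
      using that inj by (simp add: f_def the_inv_into_f_f)
    obtain j where "j < ?n" "u $ j \<noteq> 0"
      using u(1,2) by (metis carrier_vecD eq_vecI index_zero_vec)
    then have nz: "\<exists>v\<in>set vs. f v \<noteq> 0"
      using f by (metis nth_mem)
    have "real (vdegree G v) * f v + (\<Sum>w\<in>set vs. if (v, w) \<in> parcs G then f w else 0) = x * f v"
      if v: "v \<in> set vs" for v
    proof -
      obtain i where i: "i < ?n" "v = vs ! i" using v by (auto simp: in_set_conv_nth)
      have "(?Q *\<^sub>v u) $ i = x * f v" using u i f by simp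
      then show ?thesis using row[OF u(1) i(1) f] i f by simp
    qed
    with nz show ?R by blast
  next
    assume ?R
    then obtain f where nz: "\<exists>v\<in>set vs. f v \<noteq> 0" and
      f: "\<And>v. v \<in> set vs \<Longrightarrow> real (vdegree G v) * f v
            + (\<Sum>w\<in>set vs. if (v, w) \<in> parcs G then f w else 0) = x * f v"
      by blast
    define u where "u = vec ?n (\<lambda>i. f (vs ! i))"
    have u: "u \<in> carrier_vec ?n" by (simp add: u_def)
    obtain i where "i < ?n" "f (vs ! i) \<noteq> 0" using nz by (auto simp: in_set_conv_nth)
    then have "u $ i \<noteq> 0\<^sub>v ?n $ i" by (simp add: u_def)
    then have "u \<noteq> 0\<^sub>v ?n" by auto
    moreover have "?Q *\<^sub>v u = x \<cdot>\<^sub>v u"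
    proof (rule eq_vecI)
      fix i assume "i < dim_vec (x \<cdot>\<^sub>v u)"
      then have i: "i < ?n" by (simp add: u_def)
      show "(?Q *\<^sub>v u) $ i = (x \<cdot>\<^sub>v u) $ i"
        using row[OF u i, of f] i f[of "vs ! i"] by (simp add: u_def)
    qed (simp add: dims u_def)
    ultimately show ?L
      unfolding eigenvalue_def eigenvector_def using u dims by auto
  qed
qed

lemma signless_laplacian_spectrum_enum_indep:
  assumes "distinct vs" "distinct ws" "set vs = set ws"
  shows "spectrum (signless_laplacian G vs) = spectrum (signless_laplacian G ws)"
  unfolding spectrum_def
  by (rule Collect_cong)
    (simp only: eigenvalue_signless_laplacian_iff[OF assms(1)]
      eigenvalue_signless_laplacian_iff[OF assms(2)] assms(3))

lemma vertex_enum: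
  assumes "finite (pverts G)"
  shows "distinct (vertex_enum G)" "set (vertex_enum G) = pverts G"
  using someI_ex[of "\<lambda>vs. distinct vs \<and> set vs = pverts G"] finite_distinct_list[OF assms]
  unfolding vertex_enum_def by blast+

lemma pair_graph_cycle_graph:
  assumes "n \<ge> 2"
  shows "pair_graph (cycle_graph n)"
proof
  show "finite (parcs (cycle_graph n))"
    by (rule finite_subset[of _ "{..<n} \<times> {..<n}"]) (auto simp: cycle_graph_def)
  show "symmetric (with_proj (cycle_graph n))"
    unfolding symmetric_def by (auto simp: cycle_graph_def sym_def)
  show "fst e \<noteq> snd e" if "e \<in> parcs (cycle_graph n)" for e
  proof -
    have "Suc i mod n \<noteq> i" if "i < n" for i
      using that assms by (auto simp: mod_Suc)
    then show ?thesis using that by (force simp: cycle_graph_def)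
  qed
qed (auto simp: cycle_graph_def)

lemma pair_graph_star_plus:
  assumes "3 * s \<le> m"
  shows "pair_graph (star_plus m s)"
proof
  show "symmetric (with_proj (star_plus m s))"
    unfolding symmetric_def by (auto simp: star_plus_def sym_def)
qed (use assms in \<open>auto simp: star_plus_def\<close>)

lemma edge_count_star_plus:
  assumes "3 * s \<le> m"
  shows "edge_count (star_plus m s) = m"
proof -
  let ?A = "(\<lambda>i. {0, i}) ` {1..m - s}" and ?B = "(\<lambda>i. {2 * i - 1, 2 * i}) ` {1..s}"
  have "(\<lambda>(u, v). {u, v}) ` parcs (star_plus m s) = ?A \<union> ?B"
    by (auto simp: star_plus_def image_Un image_UN insert_commute)
  moreover have "card ?A = m - s"
    by (subst card_image) (auto simp: inj_on_def doubleton_eq_iff)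
  moreover have "card ?B = s"
  proof (subst card_image)
    show "inj_on (\<lambda>i. {2 * i - 1, 2 * i}) {1..s}"
      by (rule inj_onI) (auto simp: doubleton_eq_iff)
  qed simp
  moreover have "?A \<inter> ?B = {}"
    by (auto simp: doubleton_eq_iff)
  ultimately show ?thesis
    unfolding edge_count_def using assms by (simp add: card_Un_disjoint)
qed

end

theory Submission
  imports Defs
begin

text \<open>
  Write \<open>d = m - k - 1\<close> and \<open>s = k + 1\<close>. The equitable partition of \<open>S\<^sup>+\<^sub>m\<^sub>,\<^sub>s\<close> shows that its index
  is at least the root \<open>L > d + 1\<close> of \<open>L (L - 3) (L - 1 - d) = 4 s\<close>, so it suffices to find a
  positive vector \<open>f\<close> with \<open>Q f < L f\<close> entrywise. If every degree is below \<open>d\<close>, the degree vector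
  works, because in a \<open>C\<^sub>4\<close>-free graph the degrees of the neighbours of \<open>v\<close> add up to at most
  \<open>m\<close> plus the number of triangles at \<open>v\<close>. Otherwise some vertex \<open>r\<close> has degree \<open>d\<close>, and only
  \<open>s\<close> edges avoid it. Start from the eigenvector of a star with triangles at \<open>r\<close> and perturb it
  according to the edges that leave the neighbourhood: an edge that closes a triangle contributes
  about \<open>4 / L\<^sup>2\<close> to the equation at \<open>r\<close>, any other edge strictly less, so \<open>Q f < L f\<close>
  can be achieved unless all \<open>s\<close> edges close triangles, which is the extremal graph.
\<close>

section \<open>The spectrum of a real symmetric matrix\<close>

text \<open>A complex eigenvalue \<open>c\<close> with eigenvector \<open>u\<close> exists. The
  Hermitian form \<open>F\<close> is \<open>c\<close> times the squared norm of \<open>u\<close>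
  and, by symmetry of \<open>A\<close>, equals its own conjugate, so \<open>c\<close> is real. As a
  root of the characteristic polynomial it then lies in the spectrum of \<open>A\<close>
  itself.\<close>

lemma symmetric_real_eigenvalue_exists:
  fixes A :: "real mat"
  assumes A: "A \<in> carrier_mat n n" and n: "n > 0"
    and sym: "\<And>i j. i < n \<Longrightarrow> j < n \<Longrightarrow> A $$ (i, j) = A $$ (j, i)"
  shows "spectrum A \<noteq> {}"
proof -
  let ?C = "map_mat complex_of_real A"
  have C: "?C \<in> carrier_mat n n" using A by simp
  obtain c where "eigenvalue ?C c"
    using spectrum_non_empty[OF C n] by (auto simp: spectrum_def)
  then obtain u where u: "u \<in> carrier_vec n" "u \<noteq> 0\<^sub>v n" "?C *\<^sub>v u = c \<cdot>\<^sub>v u"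
    using A by (auto simp: eigenvalue_def eigenvector_def)
  have row: "(\<Sum>j<n. of_real (A $$ (i, j)) * u $ j) = c * u $ i" if "i < n" for i
  proof -
    have "(?C *\<^sub>v u) $ i = c * u $ i" using u that by simp
    moreover have "(?C *\<^sub>v u) $ i = (\<Sum>j<n. of_real (A $$ (i, j)) * u $ j)"
      using u(1) A that by (simp add: scalar_prod_def atLeast0LessThan)
    ultimately show ?thesis by simp
  qed
  define S where "S = (\<Sum>i<n. (cmod (u $ i))\<^sup>2)"
  define F where "F = (\<Sum>i<n. \<Sum>j<n. cnj (u $ i) * of_real (A $$ (i, j)) * u $ j)"
  obtain i where i: "i < n" "u $ i \<noteq> 0"
    using u(1,2) by (metis carrier_vecD eq_vecI index_zero_vec)
  have "0 < (cmod (u $ i))\<^sup>2" using i by simp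
  also have "\<dots> \<le> S" unfolding S_def using i by (intro member_le_sum) auto
  finally have S: "S > 0" .
  have "F = (\<Sum>i<n. cnj (u $ i) * (c * u $ i))"
    unfolding F_def by (intro sum.cong refl) (simp add: row[symmetric] sum_distrib_left mult.assoc)
  also have "\<dots> = c * of_real S"
    unfolding S_def of_real_sum sum_distrib_left
    by (intro sum.cong refl) (simp add: complex_norm_square mult_ac del: of_real_power)
  finally have F: "F = c * of_real S" .
  have "cnj F = (\<Sum>i<n. \<Sum>j<n. u $ i * of_real (A $$ (i, j)) * cnj (u $ j))"
    unfolding F_def by simp
  also have "\<dots> = (\<Sum>j<n. \<Sum>i<n. u $ i * of_real (A $$ (i, j)) * cnj (u $ j))"
    by (rule sum.swap)
  also have "\<dots> = F"
    unfolding F_def by (intro sum.cong refl) (auto simp: sym mult_ac)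
  finally have "cnj c * of_real S = c * of_real S" using F by simp
  with S have "cnj c = c" by simp
  then obtain r where r: "c = of_real r"
    by (metis Reals_cnj_iff Reals_cases)
  have "poly (char_poly ?C) (of_real r) = 0"
    using \<open>eigenvalue ?C c\<close> eigenvalue_root_char_poly[OF C] r by simp
  then have "poly (char_poly A) r = 0"
    by (simp add: of_real_hom.char_poly_hom[OF A])
  then show ?thesis
    using eigenvalue_root_char_poly[OF A] by (auto simp: spectrum_def)
qed

section \<open>The signless Laplacian index\<close>

definition neighbors :: "'a pair_pre_digraph \<Rightarrow> 'a \<Rightarrow> 'a set" where
  "neighbors G v = {w. (v, w) \<in> parcs G}"

lemma vdegree_eq_card_neighbors: "vdegree G v = card (neighbors G v)"
proof -
  have "out_arcs (with_proj G) v = Pair v ` neighbors G v"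
    by (auto simp: out_arcs_def neighbors_def)
  then show ?thesis
    by (simp add: out_degree_def card_image inj_on_def)
qed

context pair_graph
begin

lemma neighbors_subset: "neighbors G v \<subseteq> pverts G"
  by (auto simp: neighbors_def dest: in_arcsD2)

lemma finite_neighbors [simp]: "finite (neighbors G v)"
  using finite_subset[OF neighbors_subset pair_finite_verts] .

lemma neighbors_sym: "w \<in> neighbors G v \<longleftrightarrow> v \<in> neighbors G w"
  by (auto simp: neighbors_def dest: arcs_symmetric)

lemma not_self_neighbor [simp]: "v \<notin> neighbors G v"
  by (auto simp: neighbors_def dest: no_loops')

lemma sum_neighbors:
  "(\<Sum>w\<in>pverts G. if (v, w) \<in> parcs G then f w else 0) = (\<Sum>w\<in>neighbors G v. f w)"
proof -
  have "neighbors G v = pverts G \<inter> neighbors G v" using neighbors_subset by blast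
  then have "(\<Sum>w\<in>neighbors G v. f w) = (\<Sum>w\<in>pverts G \<inter> neighbors G v. f w)" by simp
  also have "\<dots> = (\<Sum>w\<in>pverts G. if w \<in> neighbors G v then f w else 0)"
    by (rule sum.inter_restrict[OF pair_finite_verts])
  finally show ?thesis by (simp add: neighbors_def)
qed

text \<open>From here on eigenvectors are functions on the vertices, and the enumeration
  disappears.\<close>

lemma eigenvalue_iff:
  "eigenvalue (signless_laplacian G (vertex_enum G)) x \<longleftrightarrow>
    (\<exists>f :: 'a \<Rightarrow> real. (\<exists>v\<in>pverts G. f v \<noteq> 0) \<and>
      (\<forall>v\<in>pverts G. real (card (neighbors G v)) * f v + (\<Sum>w\<in>neighbors G v. f w) = x * f v))"
  using eigenvalue_signless_laplacian_iff[OF vertex_enum(1)[OF pair_finite_verts]]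
  by (simp add: vertex_enum(2)[OF pair_finite_verts] sum_neighbors vdegree_eq_card_neighbors)

lemma finite_spectrum: "finite (spectrum (signless_laplacian G (vertex_enum G)))"
  by (rule card_finite_spectrum(1)[of _ "length (vertex_enum G)"])
    (simp add: signless_laplacian_def degree_matrix_def adjacency_matrix_def)

lemma q_index_eigenvalue:
  assumes "pverts G \<noteq> {}"
  shows "eigenvalue (signless_laplacian G (vertex_enum G)) (q_index G)"
proof -
  let ?vs = "vertex_enum G"
  have "spectrum (signless_laplacian G ?vs) \<noteq> {}"
  proof (rule symmetric_real_eigenvalue_exists)
    show "signless_laplacian G ?vs \<in> carrier_mat (length ?vs) (length ?vs)"
      by (simp add: signless_laplacian_def degree_matrix_def adjacency_matrix_def)
    show "length ?vs > 0"
      using assms vertex_enum(2)[OF pair_finite_verts] by auto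
  qed (use arcs_symmetric in \<open>auto simp: signless_laplacian_nth\<close>)
  from Max_in[OF finite_spectrum this] show ?thesis
    by (simp add: q_index_def spectrum_def)
qed

lemma q_index_ge:
  assumes "eigenvalue (signless_laplacian G (vertex_enum G)) x"
  shows "x \<le> q_index G"
  unfolding q_index_def using assms by (intro Max_ge finite_spectrum) (simp add: spectrum_def)

text \<open>
  The easy half of the Collatz--Wielandt characterisation, which needs no connectivity: compare an
  eigenvector with \<open>f\<close> at a vertex where their quotient is largest.
\<close>

lemma q_index_less:
  fixes f :: "'a \<Rightarrow> real"
  assumes ne: "pverts G \<noteq> {}" and pos: "\<And>v. v \<in> pverts G \<Longrightarrow> f v > 0"
    and less: "\<And>v. v \<in> pverts G \<Longrightarrow>
      real (card (neighbors G v)) * f v + (\<Sum>w\<in>neighbors G v. f w) < x * f v"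
  shows "q_index G < x"
proof -
  obtain g where nz: "\<exists>v\<in>pverts G. g v \<noteq> 0" and g: "\<And>v. v \<in> pverts G \<Longrightarrow>
      real (card (neighbors G v)) * g v + (\<Sum>w\<in>neighbors G v. g w) = q_index G * g v"
    using q_index_eigenvalue[OF ne] unfolding eigenvalue_iff by blast
  let ?r = "\<lambda>v. \<bar>g v\<bar> / f v"
  define R where "R = Max (?r ` pverts G)"
  have "R \<in> ?r ` pverts G" unfolding R_def using ne pair_finite_verts by (intro Max_in) auto
  then obtain v where v: "v \<in> pverts G" "R = ?r v" by blast
  have le: "\<bar>g w\<bar> \<le> R * f w" if "w \<in> pverts G" for w
  proof -
    have "?r w \<le> R" unfolding R_def using that pair_finite_verts by (intro Max_ge) auto
    then show ?thesis using pos[OF that] by (simp add: field_simps)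
  qed
  obtain u where u: "u \<in> pverts G" "g u \<noteq> 0" using nz by blast
  have "R > 0" using le[OF u(1)] u pos[OF u(1)]
    by (smt (verit, best) mult_le_0_iff)
  have eq: "\<bar>g v\<bar> = R * f v" using v pos[OF v(1)] by simp
  \<comment> \<open>At \<open>v\<close> the bound \<open>le\<close> is an equality, while at its
    neighbours it is an upper bound. Estimating the eigenvalue equation at \<open>v\<close> term by
    term thus reduces it to the hypothesis on \<open>f\<close>.\<close>
  have "q_index G * \<bar>g v\<bar> \<le> \<bar>q_index G * g v\<bar>"
    by (simp add: abs_mult mult_right_mono)
  also have "\<dots> = \<bar>real (card (neighbors G v)) * g v + (\<Sum>w\<in>neighbors G v. g w)\<bar>"
    using g[OF v(1)] by simp
  also have "\<dots> \<le> real (card (neighbors G v)) * \<bar>g v\<bar> + (\<Sum>w\<in>neighbors G v. \<bar>g w\<bar>)"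
    by (intro order_trans[OF abs_triangle_ineq] add_mono sum_abs) (simp add: abs_mult)
  also have "\<dots> \<le> real (card (neighbors G v)) * (R * f v) + (\<Sum>w\<in>neighbors G v. R * f w)"
    using neighbors_subset[of v] unfolding eq by (intro add_mono sum_mono le) auto
  also have "\<dots> = R * (real (card (neighbors G v)) * f v + (\<Sum>w\<in>neighbors G v. f w))"
    by (simp add: sum_distrib_left algebra_simps)
  also have "\<dots> < R * (x * f v)"
    using less[OF v(1)] \<open>R > 0\<close> by simp
  finally have "q_index G * (R * f v) < x * (R * f v)"
    unfolding eq by (simp add: algebra_simps)
  then show ?thesis
    using \<open>R > 0\<close> pos[OF v(1)] by simp
qed

section \<open>Counting edges around a vertex\<close>

text \<open>The arcs are grouped by their unordered pair of ends; each group consists of two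
  opposite arcs.\<close>

lemma sum_degrees: "(\<Sum>v\<in>pverts G. card (neighbors G v)) = 2 * edge_count G"
proof -
  let ?e = "\<lambda>(u, v). {u, v}"
  have arcs: "parcs G = Sigma (pverts G) (neighbors G)"
    by (auto simp: neighbors_def dest: in_arcsD1)
  have "(\<Sum>v\<in>pverts G. card (neighbors G v)) = card (parcs G)"
    unfolding arcs using pair_finite_verts by simp
  also have "\<dots> = (\<Sum>e\<in>?e ` parcs G. card {a \<in> parcs G. ?e a = e})"
    using pair_finite_arcs sum.image_gen[of "parcs G" "\<lambda>_. 1::nat" ?e] by simp
  also have "\<dots> = (\<Sum>e\<in>?e ` parcs G. 2)"
  proof (rule sum.cong)
    fix e assume "e \<in> ?e ` parcs G"
    then obtain u v where uv: "(u, v) \<in> parcs G" "e = {u, v}" by auto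
    then have "{a \<in> parcs G. ?e a = e} = {(u, v), (v, u)}"
      using arcs_symmetric[OF uv(1)]
      by (fastforce simp: doubleton_eq_iff[of _ _ u v] split: prod.splits)
    moreover have "u \<noteq> v" using uv no_loops' by blast
    ultimately show "card {a \<in> parcs G. ?e a = e} = 2" by simp
  qed simp
  finally show ?thesis by (simp add: edge_count_def)
qed

end

text \<open>\<open>common\<close> expresses that there is no 4-cycle: two common neighbours of
  distinct vertices would close one. All counting is relative to the distance classes of a fixed
  root.\<close>

locale rooted_C4_free_graph = pair_graph +
  fixes r
  assumes root: "r \<in> pverts G"
    and common: "u \<noteq> w \<Longrightarrow> card (neighbors G u \<inter> neighbors G w) \<le> 1"
begin

definition N where "N = neighbors G r"
definition Far where "Far = pverts G - insert r N"
text \<open>For \<open>u\<close> in \<open>N\<close> this is the number of triangles through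
  \<open>r\<close> and \<open>u\<close>.\<close>

definition T where "T u = card (neighbors G u \<inter> N)"
definition A where "A u = card (neighbors G u \<inter> Far)"

lemma finite_N [simp]: "finite N"
  by (simp add: N_def)

lemma finite_Far [simp]: "finite Far"
  by (simp add: Far_def pair_finite_verts)

lemma r_notin_N [simp]: "r \<notin> N"
  by (simp add: N_def)

lemma neighbor_root_iff: "r \<in> neighbors G u \<longleftrightarrow> u \<in> N"
  unfolding N_def by (rule neighbors_sym)

lemma vertices_partition: "pverts G = insert r (N \<union> Far)" "N \<inter> Far = {}" "r \<notin> Far"
  using root neighbors_subset[of r] by (auto simp: Far_def N_def)

lemma neighbors_partition:
  "neighbors G u = (neighbors G u \<inter> {r}) \<union> (neighbors G u \<inter> N) \<union> (neighbors G u \<inter> Far)"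
  using neighbors_subset[of u] vertices_partition by blast

lemma sum_neighbors_partition:
  fixes f :: "'a \<Rightarrow> 'c::comm_monoid_add"
  shows "sum f (neighbors G u) = (if u \<in> N then f r else 0)
    + sum f (neighbors G u \<inter> N) + sum f (neighbors G u \<inter> Far)"
proof -
  have "sum f (neighbors G u) = sum f (neighbors G u \<inter> {r})
      + sum f (neighbors G u \<inter> N) + sum f (neighbors G u \<inter> Far)"
  proof -
    have "sum f (neighbors G u) =
        sum f ((neighbors G u \<inter> {r}) \<union> (neighbors G u \<inter> N) \<union> (neighbors G u \<inter> Far))"
      using neighbors_partition by simp
    also have "\<dots> = sum f ((neighbors G u \<inter> {r}) \<union> (neighbors G u \<inter> N))
        + sum f (neighbors G u \<inter> Far)"
      using vertices_partition(2,3) by (intro sum.union_disjoint) auto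
    also have "sum f ((neighbors G u \<inter> {r}) \<union> (neighbors G u \<inter> N))
        = sum f (neighbors G u \<inter> {r}) + sum f (neighbors G u \<inter> N)"
      by (intro sum.union_disjoint) auto
    finally show ?thesis .
  qed
  then show ?thesis
    by (cases "u \<in> N") (simp_all add: neighbor_root_iff[symmetric])
qed

lemma degree_eq: "card (neighbors G u) = (if u \<in> N then 1 else 0) + T u + A u"
  using sum_neighbors_partition[of "\<lambda>_. 1::nat" u] by (simp add: T_def A_def)

text \<open>Neighbours of \<open>u\<close> in \<open>N\<close> are common neighbours of
  \<open>u\<close> and \<open>r\<close>.\<close>

lemma T_le_1:
  assumes "u \<noteq> r"
  shows "T u \<le> 1"
  using common[OF assms] by (simp add: T_def N_def)

text \<open>Both sides count the edges between \<open>N\<close> and \<open>Far\<close>.\<close>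

lemma sum_T_Far: "sum T Far = sum A N"
proof -
  have "card (neighbors G u \<inter> S) = (\<Sum>w\<in>S. if w \<in> neighbors G u then 1 else 0)"
    if "finite S" for u S
    using sum.inter_restrict[OF that, of "\<lambda>_. 1::nat" "neighbors G u"] by (simp add: Int_commute)
  then have T: "sum T Far = (\<Sum>u\<in>Far. \<Sum>w\<in>N. if w \<in> neighbors G u then 1 else 0)"
    and A: "sum A N = (\<Sum>w\<in>N. \<Sum>u\<in>Far. if u \<in> neighbors G w then 1 else 0)"
    by (simp_all add: T_def A_def)
  show ?thesis
    unfolding T A by (subst sum.swap) (intro sum.cong refl if_cong neighbors_sym)
qed

text \<open>The degree sum, split at the root. Edges between \<open>N\<close> and \<open>Far\<close>
  are seen from both ends, whence the factor of \<open>sum A N\<close>; \<open>sum T N\<close> and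
  \<open>sum A Far\<close> already count each inner edge twice.\<close>

lemma edge_count_eq: "2 * edge_count G = 2 * card N + sum T N + 2 * sum A N + sum A Far"
proof -
  have "2 * edge_count G = (\<Sum>v\<in>pverts G. card (neighbors G v))"
    by (simp add: sum_degrees)
  also have "\<dots> = card N + (\<Sum>v\<in>N. card (neighbors G v)) + (\<Sum>v\<in>Far. card (neighbors G v))"
    using vertices_partition(2,3)
    by (simp add: vertices_partition(1) sum.union_disjoint N_def)
  also have "(\<Sum>v\<in>N. card (neighbors G v)) = card N + sum T N + sum A N"
    by (simp add: degree_eq sum.distrib del: add_Suc plus_1_eq_Suc)
  also have "(\<Sum>v\<in>Far. card (neighbors G v)) = (\<Sum>v\<in>Far. T v + A v)"
    using vertices_partition(2) by (intro sum.cong) (auto simp: degree_eq)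
  also have "\<dots> = sum A N + sum A Far"
    by (simp add: sum.distrib sum_T_Far)
  finally show ?thesis by simp
qed

text \<open>\<open>sum T N\<close> is twice the number of triangles at \<open>r\<close> and at most
  \<open>card N\<close>. Doubling the inequality avoids halves.\<close>

lemma sum_neighbor_degrees_le:
  "2 * (\<Sum>w\<in>N. card (neighbors G w)) \<le> 2 * edge_count G + card N"
proof -
  have "sum T N \<le> (\<Sum>w\<in>N. 1)" by (intro sum_mono T_le_1) auto
  moreover have "(\<Sum>v\<in>N. card (neighbors G v)) = card N + sum T N + sum A N"
    by (simp add: degree_eq sum.distrib del: add_Suc plus_1_eq_Suc)
  ultimately show ?thesis using edge_count_eq by simp
qed

text \<open>Since \<open>T\<close> is at most 1 on \<open>N\<close>, the edges inside
  \<open>N\<close> form a matching.\<close>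

lemma partner:
  assumes "w \<in> N" "p \<in> neighbors G w \<inter> N"
  shows "neighbors G w \<inter> N = {p}" "neighbors G p \<inter> N = {w}"
proof -
  have *: "neighbors G x \<inter> N = {y}" if "x \<in> N" "y \<in> neighbors G x \<inter> N" for x y
  proof -
    have "card (neighbors G x \<inter> N) \<le> 1"
      using T_le_1[of x] that(1) r_notin_N by (cases "x = r") (simp_all add: T_def)
    then have "\<forall>a\<in>neighbors G x \<inter> N. \<forall>b\<in>neighbors G x \<inter> N. a = b"
      by (simp add: card_le_Suc0_iff_eq)
    then show ?thesis using that(2) by blast
  qed
  show "neighbors G w \<inter> N = {p}" by (rule *) fact+
  show "neighbors G p \<inter> N = {w}"
    using assms neighbors_sym[of p w] by (intro *) auto
qed

lemma T_eq_0_or_partner: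
  assumes "w \<in> N"
  obtains "T w = 0" "neighbors G w \<inter> N = {}"
  | p where "T w = 1" "T p = 1" "p \<in> N" "neighbors G w \<inter> N = {p}" "neighbors G p \<inter> N = {w}"
proof (cases "neighbors G w \<inter> N = {}")
  case True
  then show ?thesis using that(1) by (simp add: T_def)
next
  case False
  then obtain p where p: "p \<in> neighbors G w \<inter> N" by blast
  from partner[OF assms p] show ?thesis using p by (intro that(2)) (auto simp: T_def)
qed

text \<open>Each vertex of \<open>N\<close> is the partner of at most one vertex, so its
  \<open>A\<close> enters the left side at most once.\<close>

lemma sum_partner_A_le: "(\<Sum>w\<in>N. sum A (neighbors G w \<inter> N)) \<le> sum A N"
proof -
  have ind: "sum A (neighbors G w \<inter> N) = (\<Sum>p\<in>N. if p \<in> neighbors G w then A p else 0)" for w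
    using sum.inter_restrict[OF finite_N, of A "neighbors G w"] by (simp add: Int_commute)
  have "(\<Sum>w\<in>N. sum A (neighbors G w \<inter> N))
      = (\<Sum>p\<in>N. \<Sum>w\<in>N. if p \<in> neighbors G w then A p else 0)"
    unfolding ind by (rule sum.swap)
  also have "\<dots> = (\<Sum>p\<in>N. \<Sum>w\<in>N. if w \<in> neighbors G p then A p else 0)"
    by (intro sum.cong refl if_cong neighbors_sym)
  also have "\<dots> = (\<Sum>p\<in>N. T p * A p)"
  proof (rule sum.cong[OF refl])
    fix p
    show "(\<Sum>w\<in>N. if w \<in> neighbors G p then A p else 0) = T p * A p"
      using sum.inter_restrict[OF finite_N, of "\<lambda>_. A p" "neighbors G p"]
      by (simp add: Int_commute T_def)
  qed
  also have "\<dots> \<le> (\<Sum>p\<in>N. A p)"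
  proof (rule sum_mono)
    fix p assume "p \<in> N"
    then have "T p \<le> 1" by (intro T_le_1) auto
    then show "T p * A p \<le> A p" using mult_right_mono[of "T p" 1 "A p"] by simp
  qed
  finally show ?thesis .
qed

section \<open>A positive supersolution when the maximum degree is as large as possible\<close>

text \<open>The test vector is \<open>\<psi>\<close> on \<open>N\<close>, the constant
  \<open>c\<close> on \<open>Far\<close> and slightly below 1 at \<open>r\<close>. Where
  \<open>E\<close> vanishes, \<open>\<psi>\<close> has the entries of the eigenvector of the
  extremal graph: \<open>1 / (L - 3)\<close> in a triangle with \<open>r\<close> and
  \<open>1 / (L - 1)\<close> otherwise. The hypothesis \<open>extra\<close> gives strictness at
  \<open>r\<close>.\<close>

lemma q_index_less_of_extra_edges:
  fixes L :: real
  assumes edges: "edge_count G = card N + s"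
    and large: "6 * s + 24 \<le> card N"
    and L: "real (card N) + 1 < L" "L * (L - 3) * (L - 1 - card N) = 4 * s"
    and extra: "sum A N + sum A Far > 0"
  shows "q_index G < L"
proof -
  \<comment> \<open>An edge from \<open>N\<close> to \<open>Far\<close> raises \<open>\<psi>\<close> by \<open>\<gamma>\<close> at its end in \<open>N\<close> and at the partner of that end;
    this requires \<open>\<gamma>\<close> slightly above \<open>1 / L\<^sup>2\<close>, and affords anything below \<open>2 / L\<^sup>2\<close>.\<close>
  define \<gamma> where "\<gamma> = 3 / (2 * (L - 1) * (L - 3))"
  \<comment> \<open>The value on \<open>Far\<close>: \<open>27 * c\<close> has to exceed
    \<open>2 / (L - 3)\<close> for the vertices of \<open>Far\<close>, yet \<open>\<gamma>\<close>
    has to absorb \<open>c\<close> in \<open>\<gamma>_large\<close>.\<close>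
  define c where "c = 1 / (13 * (L - 3))"
  \<comment> \<open>Edges to \<open>Far\<close> are counted at both ends of a matching edge, so
    partners get equal values of \<open>\<psi>\<close>; \<open>partner_sum\<close> rests on
    this.\<close>
  define E where "E w = A w + sum A (neighbors G w \<inter> N)" for w
  define \<psi> where "\<psi> w = 1 / (L - 1 - 2 * T w) + \<gamma> * E w" for w
  have count: "2 * s = sum T N + 2 * sum A N + sum A Far"
    using edge_count_eq edges by simp
  then have s: "s \<ge> 1" using extra by linarith
  then have s': "real s \<ge> 1" by simp
  have "L > real (6 * s + 25)" using L(1) large by linarith
  then have L25: "L > 6 * real s + 25" by simp
  then have L31: "L > 31" using s' by linarith
  have \<gamma>: "\<gamma> > 0" and c: "c > 0" using L31 by (simp_all add: \<gamma>_def c_def)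
  have A_le: "A w \<le> s" if "w \<in> N" for w
  proof -
    have "A w \<le> sum A N" using that by (intro member_le_sum) auto
    then show ?thesis using count by linarith
  qed
  have T01: "T w = 0 \<or> T w = 1" if "w \<in> N" for w
    using T_le_1[of w] that r_notin_N by (cases "w = r") (auto simp: le_Suc_eq)
  have \<psi>_pos: "\<psi> w > 0" if "w \<in> N" for w
  proof -
    have "1 / (L - 1 - 2 * T w) > 0" using T01[OF that] L31 by auto
    then show ?thesis
      unfolding \<psi>_def using \<gamma> by (intro add_pos_nonneg mult_nonneg_nonneg) simp_all
  qed
  \<comment> \<open>A crude bound for use at the vertices of \<open>Far\<close>: both summands of
    \<open>\<psi>\<close> are at most \<open>1 / (L - 3)\<close>.\<close>
  have \<psi>_le: "\<psi> w \<le> 2 / (L - 3)" if w: "w \<in> N" for w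
  proof -
    have "sum A (neighbors G w \<inter> N) \<le> sum A N" by (intro sum_mono2) auto
    then have "E w \<le> 2 * s"
      using A_le[OF w] count unfolding E_def by linarith
    then have "\<gamma> * E w \<le> \<gamma> * (2 * s)"
      using \<gamma> by (intro mult_left_mono) linarith+
    also have "\<dots> = 3 * s / (L - 1) * (1 / (L - 3))"
      using L31 by (simp add: \<gamma>_def divide_simps)
    also have "\<dots> \<le> 1 * (1 / (L - 3))"
      using L25 L31 by (intro mult_right_mono) simp_all
    also have "\<dots> = 1 / (L - 3)" by simp
    finally have "\<gamma> * E w \<le> 1 / (L - 3)" .
    moreover have "1 / (L - 1 - 2 * T w) \<le> 1 / (L - 3)"
      using T01[OF w] L31 by (auto simp: field_simps)
    ultimately show ?thesis by (simp add: \<psi>_def)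
  qed
  have \<gamma>_large: "\<gamma> * (L - 3 - a) \<ge> 1 / (L - 3) + c" if "a \<le> s" for a :: real
  proof -
    \<comment> \<open>\<open>28 / 13\<close> is twice \<open>1 + 1 / 13\<close>, so that division by
      the denominator of \<open>\<gamma>\<close> gives exactly
      \<open>1 / (L - 3) + c\<close>.\<close>
    have "28 / 13 * (L - 1) \<le> 3 * (L - 3 - a)" using L25 s' that by (simp add: field_simps)
    then have "(28 / 13 * (L - 1)) / (2 * (L - 1) * (L - 3))
        \<le> 3 * (L - 3 - a) / (2 * (L - 1) * (L - 3))"
      using L31 by (intro divide_right_mono) auto
    also have "\<dots> = \<gamma> * (L - 3 - a)" by (simp add: \<gamma>_def)
    also have "(28 / 13 * (L - 1)) / (2 * (L - 1) * (L - 3)) = 1 / (L - 3) + c"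
      using L31 by (simp add: c_def divide_simps) (simp add: algebra_simps)
    finally show ?thesis .
  qed
  \<comment> \<open>The inequality at \<open>w\<close> for \<open>f r = 1\<close>: the degree takes
    \<open>1 + T w + A w\<close> copies of \<open>\<psi> w\<close>, the partner another
    \<open>T w\<close>. The loss caused by \<open>A w\<close> is paid by
    \<open>\<gamma> * E w\<close>, as \<open>E w\<close> is at least \<open>A w\<close>.\<close>
  have \<psi>_eq: "\<psi> w * (L - 1 - 2 * T w - A w) \<ge> 1 + A w * c" if w: "w \<in> N" for w
  proof -
    define x where "x = L - 1 - 2 * T w"
    have x: "x \<ge> L - 3" using T01[OF w] by (auto simp: x_def)
    have a: "real (A w) \<le> s" using A_le[OF w] by simp
    have "A w * (1 / x + c) \<le> A w * (\<gamma> * (x - A w))"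
    proof (rule mult_left_mono)
      have "1 / x \<le> 1 / (L - 3)" using x L31 by (intro divide_left_mono) auto
      moreover have "\<gamma> * (L - 3 - A w) \<le> \<gamma> * (x - A w)"
        using x \<gamma> by (intro mult_left_mono) auto
      ultimately show "1 / x + c \<le> \<gamma> * (x - A w)"
        using \<gamma>_large[OF a] by linarith
    qed simp
    also have "\<dots> \<le> E w * (\<gamma> * (x - A w))"
    proof (rule mult_right_mono)
      have "x - A w \<ge> 0" using x a L25 by linarith
      then show "0 \<le> \<gamma> * (x - A w)" using \<gamma> by simp
    qed (simp add: E_def sum_nonneg)
    finally have "A w * (1 / x + c) \<le> E w * (\<gamma> * (x - A w))" .
    moreover have "(1 / x + \<gamma> * E w) * (x - A w) = 1 - A w / x + E w * (\<gamma> * (x - A w))"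
      using x L31 by (simp add: field_simps)
    ultimately have "(1 / x + \<gamma> * E w) * (x - A w) \<ge> 1 + A w * c"
      by (simp add: algebra_simps)
    then show ?thesis by (simp add: \<psi>_def x_def)
  qed
  have partner_sum: "sum \<psi> (neighbors G w \<inter> N) = T w * \<psi> w" if w: "w \<in> N" for w
    using w by (cases rule: T_eq_0_or_partner) (simp_all add: \<psi>_def E_def)
  \<comment> \<open>In units of \<open>q\<close>, an edge inside \<open>N\<close> costs 4, an edge
    from \<open>N\<close> to \<open>Far\<close> at most 3 and an edge inside \<open>Far\<close>
    nothing, so any extra edge keeps the total below \<open>4 * s\<close>. The cubic equation for
    \<open>L\<close> identifies that budget with
    \<open>L - card N - card N / (L - 1)\<close>.\<close>
  have sum_\<psi>: "sum \<psi> N < L - card N"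
  proof -
    define q where "q = 1 / ((L - 1) * (L - 3))"
    have q: "q > 0" using L31 by (simp add: q_def)
    have "sum E N \<le> 2 * sum A N"
      using sum_partner_A_le by (simp add: E_def sum.distrib)
    then have sum_E: "real (sum E N) \<le> 2 * real (sum A N)" by linarith
    have "sum \<psi> N = (\<Sum>w\<in>N. 1 / (L - 1) + 2 * q * T w + \<gamma> * E w)"
    proof (rule sum.cong[OF refl])
      fix w assume w: "w \<in> N"
      have "1 / (L - 1 - 2 * T w) = 1 / (L - 1) + 2 * q * T w"
        unfolding q_def using T01[OF w] L31 by (auto simp: divide_simps)
      then show "\<psi> w = 1 / (L - 1) + 2 * q * T w + \<gamma> * E w"
        by (simp add: \<psi>_def)
    qed
    also have "\<dots> = card N / (L - 1) + 2 * q * sum T N + \<gamma> * sum E N"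
      by (simp add: sum.distrib sum_distrib_left)
    also have "\<dots> \<le> card N / (L - 1) + 2 * q * sum T N + \<gamma> * (2 * sum A N)"
      using sum_E \<gamma> by (intro add_left_mono mult_left_mono) linarith+
    also have "\<gamma> = 3 / 2 * q" by (simp add: \<gamma>_def q_def)
    also have "card N / (L - 1) + 2 * q * sum T N + 3 / 2 * q * (2 * sum A N)
        = card N / (L - 1) + q * (2 * sum T N + 3 * sum A N)"
      by (simp add: algebra_simps)
    also have "\<dots> < card N / (L - 1) + q * (4 * s)"
    proof -
      have "2 * sum T N + 3 * sum A N < 4 * s" using count extra by linarith
      then have "real (2 * sum T N + 3 * sum A N) < real (4 * s)" by (simp only: of_nat_less_iff)
      then show ?thesis using q by simp
    qed
    also have "\<dots> = L - card N"
    proof -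
      have "q * (4 * s) = L * (L - 1 - card N) / (L - 1)"
        unfolding L(2)[symmetric] using L31 by (simp add: q_def divide_simps)
      then show ?thesis using L31 by (simp add: divide_simps) (simp add: algebra_simps)
    qed
    finally show ?thesis .
  qed
  have gap: "L - card N > 0" using L(1) by linarith
  \<comment> \<open>Lowering \<open>f r\<close> from 1 to \<open>1 - \<eta>\<close> spreads the slack at \<open>r\<close> to the vertices of \<open>N\<close>, where
    \<open>\<psi>_eq\<close> alone is not strict.\<close>
  define \<eta> where "\<eta> = (L - card N - sum \<psi> N) / (2 * (L - card N))"
  have "0 \<le> sum \<psi> N" by (intro sum_nonneg less_imp_le \<psi>_pos)
  then have \<eta>: "0 < \<eta>" "\<eta> < 1" using sum_\<psi> gap by (simp_all add: \<eta>_def)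
  define f where "f u = (if u = r then 1 - \<eta> else if u \<in> N then \<psi> u else c)" for u
  have f_root: "f r = 1 - \<eta>" by (simp add: f_def)
  have f_N: "f u = \<psi> u" if "u \<in> N" for u using that r_notin_N by (auto simp: f_def)
  have f_Far: "f u = c" if "u \<in> Far" for u
    using that vertices_partition(2,3) by (auto simp: f_def)
  have sum_N: "sum f (neighbors G u \<inter> N) = sum \<psi> (neighbors G u \<inter> N)" for u
    by (intro sum.cong) (auto simp: f_N)
  have sum_Far: "sum f (neighbors G u \<inter> Far) = A u * c" for u
    by (simp add: f_Far A_def)
  show ?thesis
  proof (rule q_index_less)
    show "pverts G \<noteq> {}" using root by blast
    show "f u > 0" if "u \<in> pverts G" for u
      using \<psi>_pos c \<eta> by (simp add: f_def)
    show "real (card (neighbors G u)) * f u + sum f (neighbors G u) < L * f u"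
      if u: "u \<in> pverts G" for u
    proof -
      consider "u = r" | "u \<in> N" | "u \<in> Far" using u vertices_partition(1) by blast
      then show ?thesis
      proof cases
        case 1
        have "sum f (neighbors G r) = sum \<psi> N"
          unfolding N_def[symmetric] by (intro sum.cong) (auto simp: f_N)
        \<comment> \<open>\<open>\<eta>\<close> puts the left side halfway between
          \<open>sum \<psi> N\<close> and \<open>L - card N\<close>.\<close>
        moreover have "(L - card N) * (1 - \<eta>) = (L - card N + sum \<psi> N) / 2"
          using gap by (simp add: \<eta>_def divide_simps) (simp add: algebra_simps)
        then have "sum \<psi> N < (L - card N) * (1 - \<eta>)" using sum_\<psi> by simp
        ultimately show ?thesis unfolding 1 f_root N_def[symmetric] by (simp add: algebra_simps)
      next
        case 2
        have "sum f (neighbors G u) = 1 - \<eta> + T u * \<psi> u + A u * c"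
          using 2 by (simp add: sum_neighbors_partition f_root sum_N sum_Far partner_sum)
        moreover have "real (card (neighbors G u)) = 1 + T u + A u"
          using 2 by (simp add: degree_eq)
        ultimately show ?thesis
          using \<psi>_eq[OF 2] \<eta>(1) by (simp add: f_N[OF 2] algebra_simps)
      next
        case 3
        have u': "u \<notin> N" "u \<noteq> r" using 3 vertices_partition by auto
        \<comment> \<open>At least 27 copies of \<open>c\<close> remain after all terms in
          \<open>c\<close>, and they outweigh the single possible neighbour in
          \<open>N\<close>.\<close>
        have "T u \<le> sum T Far" "A u \<le> sum A Far" using 3 by (intro member_le_sum; simp)+
        then have "T u + A u \<le> 2 * s" using count sum_T_Far by linarith
        then have "real (T u + A u) \<le> 2 * real s" by linarith
        then have "L - 2 * (T u + A u) > 27" using L25 s' by simp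
        then have "27 * c < (L - 2 * (T u + A u)) * c" using c by simp
        moreover have "sum \<psi> (neighbors G u \<inter> N) \<le> 2 / (L - 3)"
        proof -
          have "sum \<psi> (neighbors G u \<inter> N) \<le> T u * (2 / (L - 3))"
            unfolding T_def by (intro sum_bounded_above \<psi>_le) auto
          also have "\<dots> \<le> 1 * (2 / (L - 3))"
            using T_le_1[OF u'(2)] L31 by (intro mult_right_mono) auto
          finally show ?thesis by simp
        qed
        moreover have "2 / (L - 3) < 27 * c" using L31 by (simp add: c_def divide_simps)
        moreover have "sum f (neighbors G u) = sum \<psi> (neighbors G u \<inter> N) + A u * c"
          using u' by (simp add: sum_neighbors_partition sum_N sum_Far)
        moreover have "card (neighbors G u) = T u + A u" using u' by (simp add: degree_eq)
        moreover have "T u * c \<ge> 0" using c by simp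
        ultimately show ?thesis
          unfolding f_Far[OF 3] by (simp add: algebra_simps)
      qed
    qed
  qed
qed

end

section \<open>Isomorphisms and subgraphs\<close>

text \<open>Arcs are pairs of vertices, so the vertex map alone determines the arc map
  \<open>map_prod h h\<close>.\<close>

lemma digraph_iso_of_bij:
  assumes "pair_wf_digraph H" "bij_betw h (pverts H) (pverts G)"
    and "parcs G = map_prod h h ` parcs H"
  shows "digraph_iso (with_proj H) (with_proj G)"
proof -
  interpret H: pair_wf_digraph H by fact
  define hom where
    "hom = \<lparr>iso_verts = h, iso_arcs = map_prod h h, iso_head = snd, iso_tail = fst\<rparr>"
  have inj: "inj_on h (pverts H)" using assms(2) by (rule bij_betw_imp_inj_on)
  have "inj_on (map_prod h h) (parcs H)"
    using map_prod_inj_on[OF inj inj]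
    by (rule inj_on_subset) (auto dest: H.in_arcsD1 H.in_arcsD2)
  with inj have "H.digraph_isomorphism hom"
    unfolding H.digraph_isomorphism_def by (simp add: hom_def H.wf_digraph_axioms)
  moreover have "with_proj G = app_iso hom (with_proj H)"
    using assms(2,3) by (simp add: app_iso_def hom_def with_proj_def bij_betw_imp_surj_on)
  ultimately show ?thesis unfolding digraph_iso_def by blast
qed

context pair_graph
begin

text \<open>The cycle runs through \<open>u\<close>, \<open>x\<close>, \<open>w\<close>,
  \<open>y\<close> in this order, with \<open>u\<close> and \<open>w\<close> opposite.\<close>

lemma contains_cycle_graph_4I:
  assumes "x \<in> neighbors G u \<inter> neighbors G w" "y \<in> neighbors G u \<inter> neighbors G w"
    and "x \<noteq> y" "u \<noteq> w"
  shows "contains_cycle_graph 4 G"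
proof -
  define h where "h i = [u, x, w, y] ! i" for i
  define H where "H = \<lparr>pverts = h ` {..<4}, parcs = map_prod h h ` parcs (cycle_graph 4)\<rparr>"
  have arcs: "(u, x) \<in> parcs G" "(w, x) \<in> parcs G" "(u, y) \<in> parcs G" "(w, y) \<in> parcs G"
    using assms by (auto simp: neighbors_def)
  note arcs = arcs arcs[THEN arcs_symmetric]
  have four: "{..<4} = {0, 1, 2, 3 :: nat}" by auto
  have h: "h 0 = u" "h (Suc 0) = x" "h (Suc (Suc 0)) = w" "h 2 = w" "h 3 = y" by (simp_all add: h_def)
  have step: "(h i, h ((i + 1) mod 4)) \<in> parcs G" if "i < 4" for i
  proof -
    have "i = 0 \<or> i = 1 \<or> i = 2 \<or> i = 3" using that by linarith
    then show ?thesis using arcs by (elim disjE) (simp_all add: h)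
  qed
  have cycle: "(h i, h j) \<in> parcs G" if ij: "(i, j) \<in> parcs (cycle_graph 4)" for i j
  proof -
    have "i < 4" "j < 4" "j = (i + 1) mod 4 \<or> i = (j + 1) mod 4"
      using ij by (simp_all add: cycle_graph_def)
    then show ?thesis using step[of i] step[of j] arcs_symmetric by blast
  qed
  have wf_cycle: "pair_wf_digraph (cycle_graph 4)"
    using pair_graph_cycle_graph[of 4] by (simp add: pair_graph_def pair_digraph_def pair_fin_digraph_def)
  have neq: "u \<noteq> x" "u \<noteq> y" "w \<noteq> x" "w \<noteq> y"
    using assms(1,2) not_self_neighbor by blast+
  have "inj_on h {..<4}" unfolding four using assms(3,4) neq by (simp add: h)
  then have "digraph_iso (with_proj (cycle_graph 4)) (with_proj H)"
    by (intro digraph_iso_of_bij[OF wf_cycle, of h])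
      (auto simp: H_def cycle_graph_def bij_betw_def)
  moreover have "subgraph (with_proj H) (with_proj G)"
    unfolding subgraph_def
  proof (intro conjI)
    show "verts (with_proj H) \<subseteq> verts (with_proj G)"
      using in_arcsD1[OF step] by (auto simp: H_def)
    show "arcs (with_proj H) \<subseteq> arcs (with_proj G)"
      using cycle by (auto simp: H_def)
    show "wf_digraph (with_proj G)" by (rule wf_digraph_axioms)
    show "wf_digraph (with_proj H)"
      unfolding wf_digraph_wp_iff
      by unfold_locales (auto simp: H_def cycle_graph_def)
  qed auto
  ultimately show ?thesis unfolding contains_cycle_graph_def by blast
qed

text \<open>Any \<open>t\<close> neighbours serve as leaves; edges among them do no harm, as
  subgraphs need not be induced.\<close>

lemma contains_starI:
  assumes v: "v \<in> pverts G" and t: "t \<le> card (neighbors G v)"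
  shows "contains_star t G"
proof -
  obtain S where S: "S \<subseteq> neighbors G v" "card S = t" "finite S"
    using obtain_subset_with_card_n[OF t] by blast
  define H where "H = \<lparr>pverts = {v} \<union> S, parcs = {v} \<times> S \<union> S \<times> {v}\<rparr>"
  have "v \<notin> S" using S(1) by auto
  then have "complete_bipartite_digraph 1 t (with_proj H)"
    unfolding complete_bipartite_digraph_pair_def using S
    by (intro conjI exI[of _ "{v}"] exI[of _ S]) (simp_all add: H_def)
  moreover have "subgraph (with_proj H) (with_proj G)"
    unfolding subgraph_def
  proof (intro conjI)
    show "verts (with_proj H) \<subseteq> verts (with_proj G)"
      using S(1) v neighbors_subset[of v] by (auto simp: H_def)
    show "arcs (with_proj H) \<subseteq> arcs (with_proj G)"
      using S(1) arcs_symmetric[of v] by (auto simp: H_def neighbors_def)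
    show "wf_digraph (with_proj G)" by (rule wf_digraph_axioms)
    show "wf_digraph (with_proj H)"
      unfolding wf_digraph_wp_iff by unfold_locales (auto simp: H_def)
  qed auto
  ultimately show ?thesis unfolding contains_star_def by blast
qed

end

text \<open>Induction removes one pair \<open>{x, p x}\<close> and numbers it last. The labels
  \<open>2 * i - 1\<close> and \<open>2 * i\<close> of partners are those of the extra edges in
  \<open>star_plus\<close>.\<close>

lemma involution_enumeration:
  assumes "card M = 2 * s" "finite M"
    and "\<And>x. x \<in> M \<Longrightarrow> p x \<in> M \<and> p x \<noteq> x \<and> p (p x) = x"
  shows "\<exists>e. bij_betw e {1..2 * s} M \<and> (\<forall>i\<in>{1..s}. p (e (2 * i - 1)) = e (2 * i))"
  using assms
proof (induction s arbitrary: M)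
  case 0
  then show ?case by (auto simp: bij_betw_def)
next
  case (Suc s)
  then obtain x where x: "x \<in> M" by fastforce
  let ?M = "M - {x, p x}"
  have px: "p x \<in> M" "p x \<noteq> x" "p (p x) = x" using Suc.prems(3)[OF x] by auto
  have "card ?M = 2 * s"
    using Suc.prems(1,2) x px by (subst card_Diff_subset) auto
  moreover have "p y \<in> ?M \<and> p y \<noteq> y \<and> p (p y) = y" if "y \<in> ?M" for y
    using Suc.prems(3)[of y] that px(3) by auto
  ultimately obtain e where e: "bij_betw e {1..2 * s} ?M"
    and pe: "\<And>i. i \<in> {1..s} \<Longrightarrow> p (e (2 * i - 1)) = e (2 * i)"
    using Suc.IH[of ?M] Suc.prems(2) by auto
  define e' where "e' = e(2 * s + 1 := x, 2 * s + 2 := p x)"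
  have "bij_betw e' {1..2 * s} ?M"
    using e by (rule bij_betw_cong[THEN iffD1, rotated]) (auto simp: e'_def)
  moreover have "bij_betw e' {2 * s + 1, 2 * s + 2} {x, p x}"
    using px(2) by (auto simp: e'_def bij_betw_def)
  ultimately have "bij_betw e' ({1..2 * s} \<union> {2 * s + 1, 2 * s + 2}) (?M \<union> {x, p x})"
    by (rule bij_betw_combine) auto
  moreover have "{1..2 * s} \<union> {2 * s + 1, 2 * s + 2} = {1..2 * Suc s}" by auto
  moreover have "?M \<union> {x, p x} = M" using x px by auto
  moreover have "p (e' (2 * i - 1)) = e' (2 * i)" if "i \<in> {1..Suc s}" for i
  proof (cases "i = Suc s")
    case True
    then show ?thesis by (simp add: e'_def)
  next
    case False
    then have "i \<in> {1..s}" using that by auto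
    moreover from this have "e' (2 * i - 1) = e (2 * i - 1)" "e' (2 * i) = e (2 * i)"
      by (auto simp: e'_def)
    ultimately show ?thesis using pe by metis
  qed
  ultimately show ?case by auto
qed

context rooted_C4_free_graph
begin

text \<open>Once \<open>Far\<close> is empty, the graph is the star at \<open>r\<close> plus a
  matching inside \<open>N\<close>; the edge count forces the matching to have \<open>s\<close>
  edges.\<close>

lemma digraph_iso_star_plus:
  assumes edges: "edge_count G = card N + s"
    and no_extra: "sum A N + sum A Far = 0"
    and not_isolated: "\<And>v. v \<in> pverts G \<Longrightarrow> neighbors G v \<noteq> {}"
  shows "digraph_iso (with_proj G) (with_proj (star_plus (edge_count G) s))"
proof -
  let ?S = "star_plus (edge_count G) s"
  \<comment> \<open>By \<open>sum_T_Far\<close> also \<open>T\<close> vanishes on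
    \<open>Far\<close>, so a vertex there would be isolated.\<close>
  have Far: "Far = {}"
  proof (rule ccontr)
    assume "Far \<noteq> {}"
    then obtain u where u: "u \<in> Far" by blast
    have "T u \<le> sum T Far" "A u \<le> sum A Far" using u by (intro member_le_sum; simp)+
    then have "card (neighbors G u) = 0"
      using no_extra u vertices_partition(2) sum_T_Far by (auto simp: degree_eq)
    moreover have "u \<in> pverts G" using u vertices_partition by blast
    ultimately show False using not_isolated by simp
  qed
  define M where "M = {w \<in> N. T w = 1}"
  \<comment> \<open>Meaningful only on \<open>M\<close>, where the intersection is a
    singleton.\<close>
  define p where "p w = the_elem (neighbors G w \<inter> N)" for w
  have M: "neighbors G w \<inter> N = {p w}" "p w \<in> M" "p w \<noteq> w" "p (p w) = w" if w: "w \<in> M" for w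
  proof -
    have wN: "w \<in> N" "T w \<noteq> 0" using w by (simp_all add: M_def)
    then obtain q where q: "T q = 1" "q \<in> N" "neighbors G w \<inter> N = {q}" "neighbors G q \<inter> N = {w}"
      using T_eq_0_or_partner[OF wN(1)] by metis
    then have p: "p w = q" "p q = w" by (simp_all add: p_def)
    show "neighbors G w \<inter> N = {p w}" "p w \<in> M" "p (p w) = w"
      using q by (simp_all add: p M_def)
    show "p w \<noteq> w" using q(3) not_self_neighbor[of w] unfolding p by blast
  qed
  have "sum T N = (\<Sum>w\<in>N. if T w = 1 then 1 else 0)"
  proof (rule sum.cong[OF refl])
    fix w assume "w \<in> N"
    then show "T w = (if T w = 1 then 1 else 0)" by (cases rule: T_eq_0_or_partner) simp_all
  qed
  also have "\<dots> = card M" by (simp add: M_def Collect_conj_eq sum.If_cases)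
  finally have "card M = 2 * s" using edge_count_eq edges no_extra by simp
  moreover have "finite M" by (simp add: M_def)
  ultimately obtain e where e: "bij_betw e {1..2 * s} M"
    and pe: "\<And>i. i \<in> {1..s} \<Longrightarrow> p (e (2 * i - 1)) = e (2 * i)"
    using involution_enumeration[of M s p] M(2-4) by auto
  have card_M: "2 * s \<le> card N"
    using card_mono[of N M] \<open>card M = 2 * s\<close> by (auto simp: M_def)
  obtain e2 where e2: "bij_betw e2 {2 * s + 1..card N} (N - M)"
  proof -
    have "card (N - M) = card {2 * s + 1..card N}"
      using \<open>card M = 2 * s\<close> by (subst card_Diff_subset) (auto simp: M_def)
    then show ?thesis using that finite_same_card_bij[of "{2 * s + 1..card N}" "N - M"] by auto
  qed
  \<comment> \<open>The root gets 0, the matched vertices come next in consecutive pairs, the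
    pendant ones last.\<close>
  define h where "h i = (if i = 0 then r else if i \<le> 2 * s then e i else e2 i)" for i
  have h0: "h 0 = r" by (simp add: h_def)
  have hM: "bij_betw h {1..2 * s} M"
    using e by (rule bij_betw_cong[THEN iffD1, rotated]) (auto simp: h_def)
  have hN2: "bij_betw h {2 * s + 1..card N} (N - M)"
    using e2 by (rule bij_betw_cong[THEN iffD1, rotated]) (auto simp: h_def)
  have "bij_betw h ({1..2 * s} \<union> {2 * s + 1..card N}) (M \<union> (N - M))"
    using hM hN2 by (rule bij_betw_combine) auto
  moreover have "{1..2 * s} \<union> {2 * s + 1..card N} = {1..card N}" using card_M by auto
  moreover have "M \<union> (N - M) = N" by (auto simp: M_def)
  ultimately have hN: "bij_betw h {1..card N} N" by simp
  have "bij_betw h ({0} \<union> {1..card N}) ({r} \<union> N)"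
    by (rule bij_betw_combine[OF _ hN]) (auto simp: bij_betw_def h0)
  moreover have "{0} \<union> {1..card N} = {0..card N}" by auto
  moreover have "{r} \<union> N = pverts G" using vertices_partition(1) Far by simp
  ultimately have hV: "bij_betw h {0..card N} (pverts G)" by simp
  have star: "pverts ?S = {0..card N}"
    "parcs ?S = (\<Union>i\<in>{1..card N}. {(0, i), (i, 0)})
      \<union> (\<Union>i\<in>{1..s}. {(2 * i - 1, 2 * i), (2 * i, 2 * i - 1)})"
    by (simp_all add: star_plus_def edges)
  have ph: "p (h (2 * i - 1)) = h (2 * i)" "h (2 * i - 1) \<in> M" "h (2 * i) \<in> M" if "i \<in> {1..s}" for i
  proof -
    show "p (h (2 * i - 1)) = h (2 * i)" using that pe[OF that] by (auto simp: h_def)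
    have "2 * i - 1 \<in> {1..2 * s}" "2 * i \<in> {1..2 * s}" using that by auto
    then show "h (2 * i - 1) \<in> M" "h (2 * i) \<in> M" using bij_betwE[OF hM] by blast+
  qed
  have arcs: "(x, y) \<in> parcs G \<longleftrightarrow> x = r \<and> y \<in> N \<or> y = r \<and> x \<in> N \<or> x \<in> M \<and> y = p x" for x y
  proof -
    have "(x, y) \<in> parcs G \<longleftrightarrow> y \<in> neighbors G x" by (simp add: neighbors_def)
    moreover have "y \<in> neighbors G x \<longleftrightarrow> x \<in> N" if "y = r"
      using that neighbor_root_iff by simp
    moreover have "y \<in> neighbors G x \<longleftrightarrow> y \<in> N" if "x = r"
      using that by (simp add: N_def)
    moreover have "y \<in> neighbors G x \<longleftrightarrow> x \<in> M \<and> y = p x" if "x \<noteq> r" "y \<noteq> r"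
    proof
      assume y: "y \<in> neighbors G x"
      then have "x \<in> pverts G" "y \<in> pverts G"
        using neighbors_sym neighbors_subset by blast+
      then have xy: "x \<in> N" "y \<in> N" using that \<open>{r} \<union> N = pverts G\<close> by blast+
      from xy(1) have "x \<in> M"
        using y xy(2) by (cases rule: T_eq_0_or_partner) (auto simp: M_def)
      then show "x \<in> M \<and> y = p x" using M(1)[of x] y xy(2) by blast
    next
      assume "x \<in> M \<and> y = p x"
      then show "y \<in> neighbors G x" using M(1)[of x] by blast
    qed
    moreover have "r \<notin> M" "r \<notin> N" by (auto simp: M_def)
    moreover have "p x \<noteq> r" if "x \<in> M" using M(2)[OF that] \<open>r \<notin> M\<close> by blast
    ultimately show ?thesis by blast
  qed
  have "parcs G = map_prod h h ` parcs ?S"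
  proof (intro equalityI subsetI)
    fix a assume "a \<in> parcs G"
    then obtain x y where a: "a = (x, y)"
      and xy: "x = r \<and> y \<in> N \<or> y = r \<and> x \<in> N \<or> x \<in> M \<and> y = p x"
      using arcs by (cases a) auto
    have N_h: "\<exists>i\<in>{1..card N}. z = h i" if "z \<in> N" for z
      using hN that by (auto simp: bij_betw_def)
    have M_h: "\<exists>i\<in>{1..2 * s}. z = h i" if "z \<in> M" for z
      using hM that by (auto simp: bij_betw_def)
    from xy show "a \<in> map_prod h h ` parcs ?S"
    proof (elim disjE conjE)
      assume "x = r" "y \<in> N"
      then obtain i where "i \<in> {1..card N}" "y = h i" using N_h by blast
      then have "(0, i) \<in> parcs ?S" "a = map_prod h h (0, i)"
        using \<open>x = r\<close> by (auto simp: star(2) a h0)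
      then show ?thesis by blast
    next
      assume "y = r" "x \<in> N"
      then obtain i where "i \<in> {1..card N}" "x = h i" using N_h by blast
      then have "(i, 0) \<in> parcs ?S" "a = map_prod h h (i, 0)"
        using \<open>y = r\<close> by (auto simp: star(2) a h0)
      then show ?thesis by blast
    next
      assume "x \<in> M" "y = p x"
      then obtain i where i: "i \<in> {1..2 * s}" "x = h i" using M_h by blast
      show ?thesis
      proof (cases "even i")
        case True
        then obtain j where j: "i = 2 * j" by blast
        then have j': "j \<in> {1..s}" using i by auto
        have "p (h (2 * j)) = h (2 * j - 1)"
          using ph[OF j'] M(4)[of "h (2 * j - 1)"] by simp
        then have "a = map_prod h h (2 * j, 2 * j - 1)" using a i j \<open>y = p x\<close> by simp
        moreover have "(2 * j, 2 * j - 1) \<in> parcs ?S" using j' unfolding star(2) by blast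
        ultimately show ?thesis by blast
      next
        case False
        define j where "j = (i + 1) div 2"
        have j: "i = 2 * j - 1" "j \<in> {1..s}" using False i(1) by (auto simp: j_def elim!: oddE)
        then have "a = map_prod h h (2 * j - 1, 2 * j)" using a i ph[OF j(2)] \<open>y = p x\<close> by simp
        moreover have "(2 * j - 1, 2 * j) \<in> parcs ?S" using j(2) unfolding star(2) by blast
        ultimately show ?thesis by blast
      qed
    qed
  next
    fix a assume "a \<in> map_prod h h ` parcs ?S"
    then obtain i j where a: "a = (h i, h j)" and "(i, j) \<in> parcs ?S" by auto
    then consider "i = 0" "j \<in> {1..card N}" | "j = 0" "i \<in> {1..card N}"
      | l where "l \<in> {1..s}" "i = 2 * l - 1" "j = 2 * l"
      | l where "l \<in> {1..s}" "i = 2 * l" "j = 2 * l - 1"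
      unfolding star(2) by blast
    then show "a \<in> parcs G"
    proof cases
      case 1
      then show ?thesis using bij_betwE[OF hN] by (simp add: a h0 arcs)
    next
      case 2
      then show ?thesis using bij_betwE[OF hN] by (simp add: a h0 arcs)
    next
      case 3
      then show ?thesis using ph[OF 3(1)] by (simp add: a arcs)
    next
      case 4
      then show ?thesis using ph[OF 4(1)] M(4)[of "h (2 * l - 1)"] by (simp add: a arcs)
    qed
  qed
  moreover have "pair_graph ?S"
    using card_M edges by (intro pair_graph_star_plus) simp
  then have wf: "pair_wf_digraph ?S"
    by (simp add: pair_graph_def pair_digraph_def pair_fin_digraph_def)
  ultimately have "digraph_iso (with_proj ?S) (with_proj G)"
    using hV by (intro digraph_iso_of_bij[of _ h]) (simp_all add: star(1))
  moreover have "wf_digraph (with_proj ?S)" using wf by (simp add: wf_digraph_wp_iff)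
  ultimately show ?thesis using digraph_iso_swap by blast
qed

end

section \<open>The index of the extremal graph\<close>

text \<open>\<open>L\<close> is an eigenvalue with an explicit eigenvector. With value 1 at the
  centre, the equations at the leaves force \<open>1 / (L - 3)\<close> on triangles and
  \<open>1 / (L - 1)\<close> elsewhere; the equation at the centre is then the cubic.\<close>

lemma q_index_star_plus_ge:
  fixes L :: real and m d s :: nat
  assumes edges: "m = d + s" and d: "2 * s \<le> d"
    and L: "L > 3" "L * (L - 3) * (L - 1 - d) = 4 * s"
  shows "L \<le> q_index (star_plus m s)"
proof -
  let ?S = "star_plus m s"
  have "pair_graph ?S" using edges d by (intro pair_graph_star_plus) simp
  then interpret S: pair_graph ?S .
  define f where "f i = (if i = 0 then 1 else if i \<le> 2 * s then 1 / (L - 3) else 1 / (L - 1))" for i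
  have V: "pverts ?S = {0..d}" by (simp add: star_plus_def edges)
  have nb: "neighbors ?S i = (if i = 0 then {1..d} else if i \<le> 2 * s
      then {0, if even i then i - 1 else i + 1} else {0})" if "i \<le> d" for i
  proof -
    have "(i, j) \<in> parcs ?S \<longleftrightarrow> i = 0 \<and> j \<in> {1..d} \<or> j = 0 \<and> i \<in> {1..d}
        \<or> (\<exists>l\<in>{1..s}. i = 2 * l - 1 \<and> j = 2 * l) \<or> (\<exists>l\<in>{1..s}. i = 2 * l \<and> j = 2 * l - 1)" for j
      by (auto simp: star_plus_def edges)
    moreover have "(\<exists>l\<in>{1..s}. i = 2 * l - 1 \<and> j = 2 * l) \<longleftrightarrow> odd i \<and> i \<le> 2 * s \<and> j = i + 1" for j
    proof
      assume "odd i \<and> i \<le> 2 * s \<and> j = i + 1"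
      then show "\<exists>l\<in>{1..s}. i = 2 * l - 1 \<and> j = 2 * l"
        by (intro bexI[of _ "(i + 1) div 2"]) (auto elim!: oddE)
    qed auto
    moreover have "(\<exists>l\<in>{1..s}. i = 2 * l \<and> j = 2 * l - 1)
        \<longleftrightarrow> even i \<and> i \<noteq> 0 \<and> i \<le> 2 * s \<and> j = i - 1" for j
    proof
      assume "even i \<and> i \<noteq> 0 \<and> i \<le> 2 * s \<and> j = i - 1"
      then show "\<exists>l\<in>{1..s}. i = 2 * l \<and> j = 2 * l - 1"
        by (intro bexI[of _ "i div 2"]) (auto elim!: evenE)
    qed auto
    ultimately have "j \<in> neighbors ?S i \<longleftrightarrow> i = 0 \<and> j \<in> {1..d} \<or> j = 0 \<and> i \<in> {1..d}
        \<or> odd i \<and> i \<le> 2 * s \<and> j = i + 1 \<or> even i \<and> i \<noteq> 0 \<and> i \<le> 2 * s \<and> j = i - 1" for j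
      by (simp add: neighbors_def)
    then show ?thesis using that by (auto simp: set_eq_iff)
  qed
  have centre: "d + (\<Sum>i\<in>{1..d}. f i) = L"
  proof -
    have "{1..d} = {1..2 * s} \<union> {2 * s + 1..d}" using d by auto
    then have "(\<Sum>i\<in>{1..d}. f i) = (\<Sum>i\<in>{1..2 * s}. f i) + (\<Sum>i\<in>{2 * s + 1..d}. f i)"
      by (simp add: sum.union_disjoint)
    also have "\<dots> = (\<Sum>i\<in>{1..2 * s}. 1 / (L - 3)) + (\<Sum>i\<in>{2 * s + 1..d}. 1 / (L - 1))"
      by (intro arg_cong2[where f = "(+)"] sum.cong) (auto simp: f_def)
    also have "\<dots> = 2 * s / (L - 3) + (real d - 2 * s) / (L - 1)"
      using d by (simp add: of_nat_diff)
    also have "\<dots> = (2 * s * (L - 1) + (real d - 2 * s) * (L - 3)) / ((L - 3) * (L - 1))"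
      using L(1) by (simp add: divide_simps)
    also have "2 * s * (L - 1) + (real d - 2 * s) * (L - 3) = (L - d) * ((L - 3) * (L - 1))"
      using L(2) by (simp add: algebra_simps)
    finally show ?thesis using L(1) by simp
  qed
  have "eigenvalue (signless_laplacian ?S (vertex_enum ?S)) L"
    unfolding S.eigenvalue_iff
  proof (intro exI[of _ f] conjI ballI)
    show "\<exists>v\<in>pverts ?S. f v \<noteq> 0" by (intro bexI[of _ 0]) (simp_all add: f_def V)
    fix i assume "i \<in> pverts ?S"
    then have i: "i \<le> d" by (simp add: V)
    consider "i = 0" | "i \<noteq> 0" "i \<le> 2 * s" | "i > 2 * s" by linarith
    then show "real (card (neighbors ?S i)) * f i + sum f (neighbors ?S i) = L * f i"
    proof cases
      case 1
      then show ?thesis using nb[of 0] centre by (simp add: f_def[of 0])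
    next
      case 2
      define j where "j = (if even i then i - 1 else i + 1)"
      have "j \<noteq> 0 \<and> j \<le> 2 * s" unfolding j_def using 2 by presburger
      then have j: "j \<noteq> 0" "j \<le> 2 * s" by simp_all
      have "neighbors ?S i = {0, j}" using nb[OF i] 2 by (simp add: j_def)
      moreover have "(L - 3) * f i = 1" "f j = f i" "f 0 = 1"
        using 2 j L(1) by (simp_all add: f_def)
      ultimately show ?thesis using j(1) by (simp add: algebra_simps)
    next
      case 3
      then have "neighbors ?S i = {0}" "f i = 1 / (L - 1)" "f 0 = 1"
        using nb[OF i] by (simp_all add: f_def)
      then show ?thesis using L(1) by (simp add: field_simps)
    qed
  qed
  then show ?thesis by (rule S.q_index_ge)
qed

text \<open>Intermediate values: the cubic vanishes at \<open>d + 1\<close> and is at least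
  \<open>4 * s\<close> at \<open>d + 2\<close>.\<close>

lemma star_plus_root_exists:
  fixes d s :: nat
  assumes "s \<ge> 1" "4 * s + 2 \<le> d"
  obtains L :: real where "real d + 1 < L" "L * (L - 3) * (L - 1 - d) = 4 * s"
proof -
  define h where "h x = x * (x - 3) * (x - 1 - real d)" for x :: real
  have d: "real d \<ge> 4 * real s + 2" using assms(2) by linarith
  have "4 * real s \<le> 1 * (real d - 1)" using d by simp
  also have "\<dots> \<le> (real d + 2) * (real d - 1)" using d by (intro mult_right_mono) simp_all
  finally have "4 * real s \<le> h (real d + 2)" by (simp add: h_def)
  moreover have h1: "h (real d + 1) = 0" by (simp add: h_def)
  moreover have "\<forall>x. real d + 1 \<le> x \<and> x \<le> real d + 2 \<longrightarrow> isCont h x"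
    unfolding h_def by (intro allI impI continuous_intros)
  ultimately obtain L where L: "real d + 1 \<le> L" "h L = 4 * real s"
    using IVT[of h "real d + 1" "4 * real s" "real d + 2"] by auto
  have "L \<noteq> real d + 1" using h1 L(2) assms(1) by auto
  with L(1) have "real d + 1 < L" by simp
  with L(2) that[of L] show ?thesis by (simp add: h_def)
qed

section \<open>Graphs of smaller maximum degree\<close>

text \<open>With the degree vector as \<open>f\<close>, it suffices that the degree squared plus the
  degrees of the neighbours is at most \<open>n\<close> times the degree, since
  \<open>n < L\<close>.\<close>

lemma (in pair_graph) q_index_less_of_small_degrees:
  fixes L :: real
  assumes common: "\<And>u w. u \<noteq> w \<Longrightarrow> card (neighbors G u \<inter> neighbors G w) \<le> 1"
    and edges: "edge_count G = m" and ne: "pverts G \<noteq> {}"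
    and not_isolated: "\<And>v. v \<in> pverts G \<Longrightarrow> neighbors G v \<noteq> {}"
    and degree: "\<And>v. v \<in> pverts G \<Longrightarrow> card (neighbors G v) + 2 \<le> n"
    and n: "2 * m + 6 \<le> 3 * n" "n < L"
  shows "q_index G < L"
proof (rule q_index_less[where f = "\<lambda>v. real (card (neighbors G v))"])
  show "pverts G \<noteq> {}" by (rule ne)
  fix v assume v: "v \<in> pverts G"
  define D where "D = card (neighbors G v)"
  have "D > 0" using not_isolated[OF v] by (simp add: D_def card_gt_0_iff)
  then show "real (card (neighbors G v)) > 0" by (simp add: D_def)
  interpret rooted_C4_free_graph G v
    by unfold_locales (fact v, fact common)
  have "D * D + (\<Sum>w\<in>N. card (neighbors G w)) \<le> n * D"
  proof (cases "D = 1")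
    \<comment> \<open>For a single neighbour the bound through \<open>m\<close> is too weak, but the
      degree bound \<open>n - 2\<close> for that neighbour suffices.\<close>
    case True
    then obtain w where w: "N = {w}" by (auto simp: D_def N_def card_1_singleton_iff)
    then have "w \<in> pverts G" using neighbors_subset[of v] by (auto simp: N_def)
    then show ?thesis using degree[of w] w True by simp
  next
    case False
    \<comment> \<open>Writing \<open>D\<close> and \<open>n - D\<close> as 2 plus a natural number
      reduces the claim to \<open>3 * a + 4 * b + 8 \<le> 2 * (a + 2) * (b + 2)\<close>.\<close>
    then obtain b where b: "D = b + 2" using \<open>D > 0\<close> le_Suc_ex[of 2 D] by (auto simp: add.commute)
    obtain a where a: "n = D + (a + 2)"
      using degree[OF v] le_Suc_ex[of "D + 2" n] by (auto simp: D_def)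
    have "2 * (\<Sum>w\<in>N. card (neighbors G w)) \<le> 2 * m + D"
      using sum_neighbor_degrees_le edges by (simp add: D_def N_def)
    moreover have "2 * m \<le> 3 * (a + b) + 6" using n(1) a b by simp
    ultimately have "2 * (D * D + (\<Sum>w\<in>N. card (neighbors G w))) \<le> 2 * (n * D)"
      unfolding a b by (simp add: algebra_simps)
    then show ?thesis by simp
  qed
  then have "real (D * D + (\<Sum>w\<in>N. card (neighbors G w))) \<le> real (n * D)"
    by (simp only: of_nat_le_iff)
  also have "\<dots> < L * D" using n(2) \<open>D > 0\<close> by simp
  finally show "real (card (neighbors G v)) * real (card (neighbors G v))
      + (\<Sum>w\<in>neighbors G v. real (card (neighbors G w))) < L * real (card (neighbors G v))"
    by (simp add: D_def N_def)
qed

section \<open>Contradiction by cases on the maximum degree\<close>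

theorem theorem1p5:
  fixes G :: "'a pair_pre_digraph" and m k :: nat
  assumes "pair_graph G"
    and "edge_count G = m"
    and "\<forall>v\<in>pverts G. vdegree G v > 0"
    and "m \<ge> max (7 * k + 31) (k\<^sup>2 + 8 * (k + 1))"
    and "q_index G \<ge> q_index (star_plus m (k + 1))"
  shows "\<not> digraph_iso (with_proj G) (with_proj (star_plus m (k + 1))) \<longrightarrow>
    contains_cycle_graph 4 G \<or> contains_star (m - k) G"
proof (rule impI, rule ccontr)
  assume not_iso: "\<not> digraph_iso (with_proj G) (with_proj (star_plus m (k + 1)))"
    and "\<not> (contains_cycle_graph 4 G \<or> contains_star (m - k) G)"
  then have no_C4: "\<not> contains_cycle_graph 4 G" and no_star: "\<not> contains_star (m - k) G"
    by simp_all
  interpret pair_graph G by fact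
  define s where "s = k + 1"
  define d where "d = m - s"
  have m: "m \<ge> 7 * k + 31" using assms(4) by simp
  \<comment> \<open>\<open>7 * k + 31\<close> equals \<open>7 * s + 24\<close>, which leaves
    \<open>6 * s + 24\<close> for \<open>d\<close>, the largest degree possible without the
    forbidden star.\<close>
  then have md: "m = d + s" "m - k = d + 1" "6 * s + 24 \<le> d"
    by (simp_all add: d_def s_def)
  have s: "s \<ge> 1" by (simp add: s_def)
  obtain L where L: "real d + 1 < L" "L * (L - 3) * (L - 1 - d) = 4 * s"
    using star_plus_root_exists[of s d] s md(3) by auto
  have "L \<le> q_index (star_plus m (k + 1))"
    unfolding s_def[symmetric]
    by (rule q_index_star_plus_ge[OF md(1) _ _ L(2)]) (use md(3) L(1) in linarith)+
  then have q: "\<not> q_index G < L" using assms(5) by linarith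
  have common: "card (neighbors G u \<inter> neighbors G w) \<le> 1" if "u \<noteq> w" for u w
  proof -
    have "\<forall>x\<in>neighbors G u \<inter> neighbors G w. \<forall>y\<in>neighbors G u \<inter> neighbors G w. x = y"
      using contains_cycle_graph_4I[OF _ _ _ that] no_C4 by blast
    then show ?thesis by (simp add: card_le_Suc0_iff_eq)
  qed
  have degree: "card (neighbors G v) \<le> d" if "v \<in> pverts G" for v
    using contains_starI[OF that, of "m - k"] no_star md(2) by fastforce
  have not_isolated: "neighbors G v \<noteq> {}" if "v \<in> pverts G" for v
    using assms(3) that by (auto simp: vdegree_eq_card_neighbors)
  have ne: "pverts G \<noteq> {}"
  proof
    assume "pverts G = {}"
    then show False using sum_degrees assms(2) m by simp
  qed
  show False
  proof (cases "\<exists>r\<in>pverts G. card (neighbors G r) = d")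
    case True
    then obtain r where r: "r \<in> pverts G" "card (neighbors G r) = d" by blast
    interpret rooted_C4_free_graph G r by unfold_locales (fact r(1), fact common)
    have N: "card N = d" using r(2) by (simp add: N_def)
    have edges: "edge_count G = card N + s" using assms(2) md(1) N by simp
    have "sum A N + sum A Far = 0"
    proof (rule ccontr)
      assume "sum A N + sum A Far \<noteq> 0"
      then have "sum A N + sum A Far > 0" by (rule neq0_conv[THEN iffD1])
      then have "q_index G < L"
        by (rule q_index_less_of_extra_edges[OF edges, rotated 3]) (simp_all add: L N md(3))
      with q show False by blast
    qed
    from digraph_iso_star_plus[OF edges this not_isolated] not_iso show False
      by (simp add: assms(2) s_def)
  next
    case False
    \<comment> \<open>All degrees are now at most \<open>d - 1\<close>, so \<open>n = d + 1\<close>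
      fits both the degree bound and \<open>d + 1 < L\<close>.\<close>
    then have "card (neighbors G v) + 2 \<le> d + 1" if "v \<in> pverts G" for v
      using degree[OF that] that by (simp add: le_neq_implies_less less_eq_Suc_le[symmetric])
    then have "q_index G < L"
      using md L(1)
      by (intro q_index_less_of_small_degrees[OF common assms(2) ne not_isolated, of "d + 1"]) simp_all
    with q show False by blast
  qed
qed

end
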